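(* Let $\mathcal{T}$ be a tiling of $\mathbb{R}^d$ which consists of bounded components. Let $\Gamma$ be a closed subgroup of $\mathrm{E}(d)$ that contains $\mathbb{R}^d$ (the translations), $\Gamma_0$ the isotropy group of $0$ in $\Gamma$, $G$ an abelian group and $\phi\colon\Gamma_0\to\mathrm{Aut}(G)$ a group homomorphism. Then for any map $f\colon\mathbb{R}^d\to G$, $f$ is $\mathcal{T}$-equivariant with representation $\phi$ if and only if $f$ is locally derivable from $\mathcal{T}$. Here $\mathcal{T}$ is regarded as an element of $\mathrm{Patch}(\mathbb{R}^d)$ and $f$ as an element of $\mathrm{Map}_{\phi\circ\pi}(\mathbb{R}^d,G,e)$, both of which are abstract pattern spaces over $(\mathbb{R}^d,\Gamma)$.
   Context: $B(x,r)$ denotes the closed Euclidean ball; $\mathrm{E}(d)\cong\mathbb{R}^d\rtimes\mathrm{O}(d)$ is the isometry group, elements written $(a,A)$; $\pi\colon\Gamma\ni(a,A)\mapsto A\in\Gamma_0$ is the projection; $e$ is the identity of $G$; $\mathrm{Aut}(G)$ is the automorphism group of $G$. Patches: a tile is an open, non-empty, bounded subset of $\mathbb{R}^d$; a patch is a set $\mathcal{P}$ of tiles such that any $S,T\in\mathcal{P}$ satisfy $S=T$ or $S\cap T=\emptyset$. $\mathrm{Patch}(\mathbb{R}^d)$ is the set of patches with cutting-off $\mathcal{P}\wedge C=\{T\in\mathcal{P}\mid T\subset C\}$ for closed $C$ and action $\gamma\mathcal{P}=\{\gamma T\mid T\in\mathcal{P}\}$; $\operatorname{supp}\mathcal{P}=\overline{\bigcup_{T\in\mathcal{P}}T}$;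 a tiling is a patch with support $\mathbb{R}^d$. $\mathcal{P}\sqcap C=\{T\in\mathcal{P}\mid T\cap C\neq\emptyset\}$. A patch $\mathcal{P}$ consists of bounded components if there is $R_{\mathcal{P}}>0$ such that for every closed $C$ and every $x\in\operatorname{supp}(\mathcal{P}\wedge C)$ one has $x\in\operatorname{supp}(\mathcal{P}\wedge C\wedge B(x,R_{\mathcal{P}}))$ (equivalently, the diameters of its tiles are bounded). $\mathrm{Map}_{\phi\circ\pi}(\mathbb{R}^d,G,e)$ is the set of all maps $f\colon\mathbb{R}^d\to G$ with $(f\wedge C)(x)=f(x)$ if $x\in C$ and $e$ otherwise, and action $(\gamma f)(x)=\phi(\pi(\gamma))(f(\gamma^{-1}x))$. Equivariance: $f\colon\mathbb{R}^d\to G$ is $\mathcal{T}$-equivariant with representation $\phi$ if there is $R>0$ such that $x,x'\in\mathbb{R}^d$, $\gamma\in\Gamma_0$ and $(\mathcal{T}\sqcap B(x',R))-x'=\gamma(\mathcal{T}\sqcap B(x,R)-x)$ imply $f(x')=\phi(\gamma)(f(x))$. Local derivability: $\mathcal{P}_2$ is locally derivable from $\mathcal{P}_1$ if there are $x_0,y_0\in\mathbb{R}^d$ and $R_0\geqq0$ such that for all $\gamma,\eta\in\Gamma$ and $R\geqq0$: $(\gamma\mathcal{P}_1)\wedge B(x_0,R+R_0)=(\eta\mathcal{P}_1)\wedge B(x_0,R+R_0)$ implies $(\gamma\mathcal{P}_2)\wedge B(y_0,R)=(\eta\mathcal{P}_2)\wedge B(y_0,R)$. *)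

theory Defs
  imports "HOL-Analysis.Analysis" "HOL-Algebra.Bij"
begin

section \<open>Euclidean isometries\<close>

text \<open>
  The pair \<open>(a, A)\<close> is the isometry \<open>x \<mapsto> A x + a\<close>, and \<open>euclidean_group\<close> is the semidirect
  product of the translations with the orthogonal group.
\<close>

type_synonym 'n isom = "(real^'n) \<times> (real^'n^'n)"

definition euclidean_group :: "'n::finite isom monoid" where
  "euclidean_group =
     \<lparr>carrier = {(a, A). orthogonal_matrix A},
      mult = (\<lambda>(a, A) (b, B). (a + A *v b, A ** B)),
      one = (0, mat 1)\<rparr>"

definition isom_app :: "'n::finite isom \<Rightarrow> real^'n \<Rightarrow> real^'n" where
  "isom_app \<gamma> x = snd \<gamma> *v x + fst \<gamma>"

definition translation :: "real^'n \<Rightarrow> 'n::finite isom" where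
  "translation a = (a, mat 1)"

definition isotropy :: "'n::finite isom set \<Rightarrow> 'n isom set" where
  "isotropy \<Gamma> = {\<gamma> \<in> \<Gamma>. isom_app \<gamma> 0 = 0}"

text \<open>
  The isotropy group of the origin consists of the pairs \<open>(0, A)\<close>, which are identified with
  their orthogonal parts \<open>A\<close>. Accordingly the projection \<open>(a, A) \<mapsto> A\<close> is encoded as
  \<open>(a, A) \<mapsto> (0, A)\<close>; it maps \<open>\<Gamma>\<close> to \<open>isotropy \<Gamma>\<close> if \<open>\<Gamma>\<close> contains the translations.
\<close>

definition linear_part :: "'n::finite isom \<Rightarrow> 'n isom" where
  "linear_part \<gamma> = (0, snd \<gamma>)"

lemma group_euclidean_group: "group (euclidean_group :: 'n::finite isom monoid)"
proof (rule groupI)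
  fix \<gamma> :: "'n isom"
  assume "\<gamma> \<in> carrier euclidean_group"
  then obtain a A where \<gamma>: "\<gamma> = (a, A)" "orthogonal_matrix A"
    by (auto simp: euclidean_group_def)
  then show "\<exists>\<eta>\<in>carrier euclidean_group. \<eta> \<otimes>\<^bsub>euclidean_group\<^esub> \<gamma> = \<one>\<^bsub>euclidean_group\<^esub>"
    by (intro bexI[of _ "(- (transpose A *v a), transpose A)"])
      (auto simp: euclidean_group_def orthogonal_matrix_def)
qed (auto simp: euclidean_group_def orthogonal_matrix_mul orthogonal_matrix_id
      matrix_vector_mul_assoc matrix_mul_assoc matrix_vector_right_distrib)

lemma linear_part_mult:
  "linear_part (\<gamma> \<otimes>\<^bsub>euclidean_group\<^esub> \<eta>) = linear_part \<gamma> \<otimes>\<^bsub>euclidean_group\<^esub> linear_part \<eta>"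
  by (cases \<gamma>, cases \<eta>) (simp add: linear_part_def euclidean_group_def)

lemma linear_part_one: "linear_part \<one>\<^bsub>euclidean_group\<^esub> = \<one>\<^bsub>euclidean_group\<^esub>"
  by (simp add: linear_part_def euclidean_group_def)

lemma isom_app_mult:
  "isom_app (\<gamma> \<otimes>\<^bsub>euclidean_group\<^esub> \<eta>) x = isom_app \<gamma> (isom_app \<eta> x)"
  by (cases \<gamma>, cases \<eta>)
    (simp add: euclidean_group_def isom_app_def matrix_vector_mul_assoc matrix_vector_right_distrib)

lemma isom_app_one: "isom_app \<one>\<^bsub>euclidean_group\<^esub> x = x"
  by (simp add: euclidean_group_def isom_app_def)

lemma isom_app_inv:
  assumes "\<gamma> \<in> carrier euclidean_group"
  shows "isom_app (inv\<^bsub>euclidean_group\<^esub> \<gamma>) (isom_app \<gamma> x) = x"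
    and "isom_app \<gamma> (isom_app (inv\<^bsub>euclidean_group\<^esub> \<gamma>) x) = x"
  by (simp_all only: isom_app_mult[symmetric] isom_app_one
      group.l_inv[OF group_euclidean_group assms] group.r_inv[OF group_euclidean_group assms])

lemma homeomorphism_isom_app:
  assumes "\<gamma> \<in> carrier (euclidean_group :: 'n::finite isom monoid)"
  shows "homeomorphism UNIV UNIV (isom_app \<gamma>) (isom_app (inv\<^bsub>euclidean_group\<^esub> \<gamma>))"
proof -
  have "continuous_on UNIV (isom_app \<eta>)" for \<eta> :: "'n isom"
    unfolding isom_app_def
    by (intro continuous_intros linear_continuous_on matrix_vector_mul_bounded_linear)
  then show ?thesis
    using isom_app_inv[OF assms] by (intro homeomorphismI) auto
qed

lemma isom_app_image_iff:
  assumes "\<gamma> \<in> carrier euclidean_group"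
  shows "isom_app \<gamma> ` S \<subseteq> isom_app \<gamma> ` T \<longleftrightarrow> S \<subseteq> T"
    and "x \<in> isom_app \<gamma> ` T \<longleftrightarrow> isom_app (inv\<^bsub>euclidean_group\<^esub> \<gamma>) x \<in> T"
    and "isom_app \<gamma> ` S = isom_app \<gamma> ` T \<longleftrightarrow> S = T"
proof -
  have "inj (isom_app \<gamma>)"
    using isom_app_inv(1)[OF assms] by (rule inj_on_inverseI)
  then show "isom_app \<gamma> ` S \<subseteq> isom_app \<gamma> ` T \<longleftrightarrow> S \<subseteq> T"
    and "isom_app \<gamma> ` S = isom_app \<gamma> ` T \<longleftrightarrow> S = T"
    by (simp_all add: inj_image_subset_iff inj_image_eq_iff)
  show "x \<in> isom_app \<gamma> ` T \<longleftrightarrow> isom_app (inv\<^bsub>euclidean_group\<^esub> \<gamma>) x \<in> T"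
    using isom_app_inv[OF assms] by (metis imageE imageI)
qed


section \<open>Pattern spaces and local derivability\<close>

record ('x, 'g, 'p) pattern_space = "'p partial_object" +
  cut :: "'p \<Rightarrow> 'x set \<Rightarrow> 'p"
  act :: "'g \<Rightarrow> 'p \<Rightarrow> 'p"

locale abstract_pattern_space = K: group K
  for K :: "'g monoid" (structure)
    and app :: "'g \<Rightarrow> 'x::metric_space \<Rightarrow> 'x"
    and \<A> :: "('x, 'g, 'p) pattern_space" +
  assumes cut_closed: "P \<in> carrier \<A> \<Longrightarrow> closed C \<Longrightarrow> cut \<A> P C \<in> carrier \<A>"
    and cut_cut: "P \<in> carrier \<A> \<Longrightarrow> closed C \<Longrightarrow> closed D \<Longrightarrow>
                    cut \<A> (cut \<A> P C) D = cut \<A> P (C \<inter> D)"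
    and support: "P \<in> carrier \<A> \<Longrightarrow>
                    \<exists>S. closed S \<and> (\<forall>C. closed C \<longrightarrow> cut \<A> P C = P \<longleftrightarrow> S \<subseteq> C)"
    and act_closed: "\<gamma> \<in> carrier K \<Longrightarrow> P \<in> carrier \<A> \<Longrightarrow> act \<A> \<gamma> P \<in> carrier \<A>"
    and act_one: "P \<in> carrier \<A> \<Longrightarrow> act \<A> \<one> P = P"
    and act_mult: "\<gamma> \<in> carrier K \<Longrightarrow> \<eta> \<in> carrier K \<Longrightarrow> P \<in> carrier \<A> \<Longrightarrow>
                     act \<A> (\<gamma> \<otimes> \<eta>) P = act \<A> \<gamma> (act \<A> \<eta> P)"
    and act_cut: "\<gamma> \<in> carrier K \<Longrightarrow> P \<in> carrier \<A> \<Longrightarrow> closed C \<Longrightarrow>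
                    act \<A> \<gamma> (cut \<A> P C) = cut \<A> (act \<A> \<gamma> P) (app \<gamma> ` C)"

definition locally_derivable ::
  "'g set \<Rightarrow> ('x::metric_space, 'g, 'p) pattern_space \<Rightarrow> ('y::metric_space, 'g, 'q) pattern_space
     \<Rightarrow> 'p \<Rightarrow> 'q \<Rightarrow> bool"
  \<comment> \<open>the second pattern is locally derivable from the first one\<close>
  where
  "locally_derivable \<Gamma> \<A>\<^sub>1 \<A>\<^sub>2 P\<^sub>1 P\<^sub>2 \<longleftrightarrow>
     (\<exists>x\<^sub>0 y\<^sub>0 R\<^sub>0. R\<^sub>0 \<ge> 0 \<and>
        (\<forall>\<gamma>\<in>\<Gamma>. \<forall>\<eta>\<in>\<Gamma>. \<forall>R\<ge>0.
           cut \<A>\<^sub>1 (act \<A>\<^sub>1 \<gamma> P\<^sub>1) (cball x\<^sub>0 (R + R\<^sub>0)) = cut \<A>\<^sub>1 (act \<A>\<^sub>1 \<eta> P\<^sub>1) (cball x\<^sub>0 (R + R\<^sub>0)) \<longrightarrow>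
           cut \<A>\<^sub>2 (act \<A>\<^sub>2 \<gamma> P\<^sub>2) (cball y\<^sub>0 R) = cut \<A>\<^sub>2 (act \<A>\<^sub>2 \<eta> P\<^sub>2) (cball y\<^sub>0 R)))"


section \<open>Patches and tilings\<close>

definition tile :: "(real^'n) set \<Rightarrow> bool" where
  "tile T \<longleftrightarrow> open T \<and> T \<noteq> {} \<and> bounded T"

definition patch :: "(real^'n) set set \<Rightarrow> bool" where
  "patch P \<longleftrightarrow> (\<forall>T\<in>P. tile T) \<and> (\<forall>S\<in>P. \<forall>T\<in>P. S = T \<or> S \<inter> T = {})"

definition patch_cut :: "(real^'n) set set \<Rightarrow> (real^'n) set \<Rightarrow> (real^'n) set set" where
  "patch_cut P C = {T \<in> P. T \<subseteq> C}"

definition patch_meet :: "(real^'n) set set \<Rightarrow> (real^'n) set \<Rightarrow> (real^'n) set set" where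
  "patch_meet P C = {T \<in> P. T \<inter> C \<noteq> {}}"

definition patch_act :: "'n::finite isom \<Rightarrow> (real^'n) set set \<Rightarrow> (real^'n) set set" where
  "patch_act \<gamma> P = (\<lambda>T. isom_app \<gamma> ` T) ` P"

definition patch_supp :: "(real^'n) set set \<Rightarrow> (real^'n) set" where
  "patch_supp P = closure (\<Union>P)"

definition tiling :: "(real^'n) set set \<Rightarrow> bool" where
  "tiling P \<longleftrightarrow> patch P \<and> patch_supp P = UNIV"

definition bounded_components :: "(real^'n) set set \<Rightarrow> bool" where
  "bounded_components P \<longleftrightarrow>
     (\<exists>R>0. \<forall>C. closed C \<longrightarrow>
        (\<forall>x \<in> patch_supp (patch_cut P C). x \<in> patch_supp (patch_cut (patch_cut P C) (cball x R))))"

definition patch_space :: "(real^'n, 'n::finite isom, (real^'n) set set) pattern_space" where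
  "patch_space = \<lparr>carrier = {P. patch P}, cut = patch_cut, act = patch_act\<rparr>"


section \<open>Maps into a group\<close>

definition map_cut :: "('g, 'b) monoid_scheme \<Rightarrow> (real^'n \<Rightarrow> 'g) \<Rightarrow> (real^'n) set \<Rightarrow> real^'n \<Rightarrow> 'g"
  where "map_cut G f C = (\<lambda>x. if x \<in> C then f x else \<one>\<^bsub>G\<^esub>)"

definition map_act ::
  "('n::finite isom \<Rightarrow> 'g \<Rightarrow> 'g) \<Rightarrow> 'n isom \<Rightarrow> (real^'n \<Rightarrow> 'g) \<Rightarrow> real^'n \<Rightarrow> 'g"
  where "map_act \<phi> \<gamma> f = (\<lambda>x. \<phi> (linear_part \<gamma>) (f (isom_app (inv\<^bsub>euclidean_group\<^esub> \<gamma>) x)))"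

definition map_space ::
  "('g, 'b) monoid_scheme \<Rightarrow> ('n::finite isom \<Rightarrow> 'g \<Rightarrow> 'g) \<Rightarrow>
     (real^'n, 'n isom, real^'n \<Rightarrow> 'g) pattern_space"
  where "map_space G \<phi> = \<lparr>carrier = UNIV \<rightarrow> carrier G, cut = map_cut G, act = map_act \<phi>\<rparr>"

definition equivariant ::
  "'n::finite isom set \<Rightarrow> (real^'n) set set \<Rightarrow> ('n isom \<Rightarrow> 'g \<Rightarrow> 'g) \<Rightarrow> (real^'n \<Rightarrow> 'g) \<Rightarrow> bool"
  where
  "equivariant \<Gamma>\<^sub>0 \<T> \<phi> f \<longleftrightarrow>
     (\<exists>R>0. \<forall>x x'. \<forall>\<gamma>\<in>\<Gamma>\<^sub>0.
        patch_act (translation (- x')) (patch_meet \<T> (cball x' R)) =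
        patch_act \<gamma> (patch_act (translation (- x)) (patch_meet \<T> (cball x R))) \<longrightarrow>
        f x' = \<phi> \<gamma> (f x))"


section \<open>Both spaces are abstract pattern spaces\<close>

lemma patch_patch_act:
  assumes "patch P" and \<gamma>: "\<gamma> \<in> carrier euclidean_group"
  shows "patch (patch_act \<gamma> P)"
proof -
  have tile: "tile (isom_app \<gamma> ` T)" if "T \<in> P" for T
  proof -
    have T: "open T" "T \<noteq> {}" "bounded T"
      using assms(1) that by (auto simp: patch_def tile_def)
    have "open (isom_app \<gamma> ` T)"
      using homeomorphism_imp_open_map[OF homeomorphism_isom_app[OF \<gamma>], of T] T(1)
      by simp
    moreover have "bounded (isom_app \<gamma> ` T)"
    proof -
      have "isom_app \<gamma> ` T = (\<lambda>y. fst \<gamma> + y) ` ((*v) (snd \<gamma>) ` T)"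
        by (simp add: isom_app_def image_image add.commute)
      then show ?thesis
        using bounded_translation[OF bounded_linear_image[OF T(3) matrix_vector_mul_bounded_linear]]
        by simp
    qed
    ultimately show ?thesis
      using T(2) by (simp add: tile_def)
  qed
  have disj: "isom_app \<gamma> ` S = isom_app \<gamma> ` T \<or> isom_app \<gamma> ` S \<inter> isom_app \<gamma> ` T = {}"
    if "S \<in> P" "T \<in> P" for S T
  proof -
    have "S = T \<or> S \<inter> T = {}"
      using assms(1) that by (simp add: patch_def)
    then show ?thesis
      using isom_app_image_iff(2)[OF \<gamma>] by (simp add: disjoint_iff) metis
  qed
  show ?thesis
    unfolding patch_def patch_act_def ball_simps using tile disj by simp
qed

lemma abstract_pattern_space_patch_space:
  assumes "subgroup \<Gamma> (euclidean_group :: 'n::finite isom monoid)"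
  shows "abstract_pattern_space (euclidean_group\<lparr>carrier := \<Gamma>\<rparr>) isom_app patch_space"
proof -
  interpret K: group "euclidean_group\<lparr>carrier := \<Gamma>\<rparr>"
    using assms group_euclidean_group by (rule subgroup.subgroup_is_group)
  have mem: "\<gamma> \<in> carrier euclidean_group" if "\<gamma> \<in> \<Gamma>" for \<gamma>
    using assms that by (rule subgroup.mem_carrier)
  show ?thesis
  proof (unfold_locales, goal_cases)
    case (3 P)
    have "patch_cut P C = P \<longleftrightarrow> closure (\<Union>P) \<subseteq> C" if "closed C" for C
    proof -
      have "patch_cut P C = P \<longleftrightarrow> \<Union>P \<subseteq> C"
        unfolding patch_cut_def by blast
      then show ?thesis
        using that closure_minimal closure_subset by (metis order_trans)
    qed
    then show ?case
      unfolding patch_space_def by (auto intro!: exI[of _ "closure (\<Union>P)"])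
  next
    case (7 \<gamma> P C)
    then have "isom_app \<gamma> ` T \<subseteq> isom_app \<gamma> ` C \<longleftrightarrow> T \<subseteq> C" for T
      using isom_app_image_iff(1)[OF mem] by simp
    then have "patch_act \<gamma> (patch_cut P C) = patch_cut (patch_act \<gamma> P) (isom_app \<gamma> ` C)"
      unfolding patch_act_def patch_cut_def by blast
    then show ?case
      by (simp add: patch_space_def)
  next
    case (6 \<gamma> \<eta> P)
    show ?case
      by (simp add: patch_space_def patch_act_def image_image isom_app_mult)
  next
    case (5 P)
    then show ?case
      by (simp add: patch_space_def patch_act_def isom_app_one)
  next
    case (4 \<gamma> P)
    then show ?case
      using patch_patch_act[OF _ mem] by (simp add: patch_space_def)
  next
    case (1 P C)
    then have "patch P"
      by (simp add: patch_space_def)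
    then have "patch (patch_cut P C)"
      unfolding patch_def patch_cut_def by blast
    then show ?case
      by (simp add: patch_space_def)
  next
    case (2 P C D)
    have "patch_cut (patch_cut P C) D = patch_cut P (C \<inter> D)"
      unfolding patch_cut_def by blast
    then show ?case
      by (simp add: patch_space_def)
  qed
qed

lemma abstract_pattern_space_map_space:
  assumes \<Gamma>: "subgroup \<Gamma> (euclidean_group :: 'n::finite isom monoid)"
    and trans: "range translation \<subseteq> \<Gamma>"
    and "comm_group G"
    and \<phi>: "\<phi> \<in> hom (euclidean_group\<lparr>carrier := isotropy \<Gamma>\<rparr>) (AutoGroup G)"
  shows "abstract_pattern_space (euclidean_group\<lparr>carrier := \<Gamma>\<rparr>) isom_app (map_space G \<phi>)"
proof -
  interpret K: group "euclidean_group\<lparr>carrier := \<Gamma>\<rparr>"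
    using \<Gamma> group_euclidean_group by (rule subgroup.subgroup_is_group)
  interpret E: group "euclidean_group :: 'n isom monoid"
    by (rule group_euclidean_group)
  interpret G: comm_group G by fact
  interpret A: group "AutoGroup G" by (rule G.AutoGroup)
  have mem: "\<gamma> \<in> carrier euclidean_group" if "\<gamma> \<in> \<Gamma>" for \<gamma>
    using \<Gamma> that by (rule subgroup.mem_carrier)
  have lin: "linear_part \<gamma> \<in> isotropy \<Gamma>" if "\<gamma> \<in> \<Gamma>" for \<gamma>
  proof -
    have "linear_part \<gamma> = translation (- fst \<gamma>) \<otimes>\<^bsub>euclidean_group\<^esub> \<gamma>"
      by (cases \<gamma>) (simp add: linear_part_def translation_def euclidean_group_def)
    moreover have "\<dots> \<in> \<Gamma>"
      using trans that by (intro subgroup.m_closed[OF \<Gamma>]) auto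
    ultimately have "linear_part \<gamma> \<in> \<Gamma>"
      by simp
    then show ?thesis
      by (simp add: isotropy_def linear_part_def isom_app_def)
  qed
  have auto: "\<phi> \<gamma> \<in> auto G" if "\<gamma> \<in> isotropy \<Gamma>" for \<gamma>
    using hom_in_carrier[OF \<phi>, of \<gamma>] that by (simp add: AutoGroup_def)
  have \<phi>_closed: "\<phi> \<gamma> u \<in> carrier G" if "\<gamma> \<in> isotropy \<Gamma>" "u \<in> carrier G" for \<gamma> u
    using auto[OF that(1)] that(2) by (auto simp: auto_def hom_def)
  have \<phi>_G_one: "\<phi> \<gamma> \<one>\<^bsub>G\<^esub> = \<one>\<^bsub>G\<^esub>" if "\<gamma> \<in> isotropy \<Gamma>" for \<gamma>
    using auto[OF that] hom_one[OF _ G.is_group G.is_group] by (auto simp: auto_def)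
  have \<phi>_mult: "\<phi> (\<gamma> \<otimes>\<^bsub>euclidean_group\<^esub> \<eta>) u = \<phi> \<gamma> (\<phi> \<eta> u)"
    if "\<gamma> \<in> isotropy \<Gamma>" "\<eta> \<in> isotropy \<Gamma>" "u \<in> carrier G" for \<gamma> \<eta> u
    using hom_mult[OF \<phi>, of \<gamma> \<eta>] auto[OF that(1)] auto[OF that(2)] that
    by (simp add: AutoGroup_def BijGroup_def auto_def compose_def)
  have one_iso: "\<one>\<^bsub>euclidean_group\<^esub> \<in> isotropy \<Gamma>"
    using subgroup.one_closed[OF \<Gamma>] by (simp add: isotropy_def isom_app_one)
  have \<phi>_one: "\<phi> \<one>\<^bsub>euclidean_group\<^esub> u = u" if "u \<in> carrier G" for u
  proof -
    have "inj_on (\<phi> \<one>\<^bsub>euclidean_group\<^esub>) (carrier G)"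
      using auto[OF one_iso] by (simp add: auto_def Bij_def bij_betw_def)
    moreover have "\<phi> \<one>\<^bsub>euclidean_group\<^esub> (\<phi> \<one>\<^bsub>euclidean_group\<^esub> u) = \<phi> \<one>\<^bsub>euclidean_group\<^esub> u"
      using \<phi>_mult[OF one_iso one_iso that] by simp
    ultimately show ?thesis
      using \<phi>_closed[OF one_iso that] that by (auto dest: inj_onD)
  qed
  show ?thesis
  proof (unfold_locales, goal_cases)
    case (3 f)
    have "map_cut G f C = f \<longleftrightarrow> closure {x. f x \<noteq> \<one>\<^bsub>G\<^esub>} \<subseteq> C" if "closed C" for C
    proof -
      have "map_cut G f C = f \<longleftrightarrow> {x. f x \<noteq> \<one>\<^bsub>G\<^esub>} \<subseteq> C"
        unfolding map_cut_def fun_eq_iff by force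
      then show ?thesis
        using closure_minimal[OF _ that] order_trans[OF closure_subset] by blast
    qed
    then show ?case
      unfolding map_space_def by (auto intro!: exI[of _ "closure {x. f x \<noteq> \<one>\<^bsub>G\<^esub>}"])
  next
    case (4 \<gamma> f)
    then show ?case
      by (auto simp: map_space_def map_act_def Pi_iff intro!: \<phi>_closed lin)
  next
    case (5 f)
    then have "f x \<in> carrier G" for x
      by (auto simp: map_space_def)
    then show ?case
      by (simp add: map_space_def map_act_def fun_eq_iff linear_part_one \<phi>_one isom_app_one)
  next
    case (6 \<gamma> \<eta> f)
    then have "f x \<in> carrier G" for x
      by (auto simp: map_space_def)
    then show ?case
      using 6 by (simp add: map_space_def map_act_def fun_eq_iff linear_part_mult \<phi>_mult lin mem
          E.inv_mult_group isom_app_mult)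
  next
    case (7 \<gamma> f C)
    then have "\<gamma> \<in> \<Gamma>"
      by simp
    then have "map_act \<phi> \<gamma> (map_cut G f C) x = map_cut G (map_act \<phi> \<gamma> f) (isom_app \<gamma> ` C) x" for x
      unfolding map_act_def map_cut_def isom_app_image_iff(2)[OF mem[OF \<open>\<gamma> \<in> \<Gamma>\<close>]]
      by (simp add: \<phi>_G_one lin)
    then show ?case
      by (simp add: map_space_def fun_eq_iff)
  next
    case (1 f C)
    then have "f x \<in> carrier G" for x
      by (auto simp: map_space_def)
    then show ?case
      by (simp add: map_space_def map_cut_def)
  next
    case (2 f C D)
    show ?case
      by (simp add: map_space_def map_cut_def fun_eq_iff)
  qed
qed

end

theory Submission
  imports Defs
begin

text \<open>
  Both conditions compare the pattern around one point with the pattern around another one, and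
  both become transparent once the two points are moved to the origin. Call \<open>f\<close> determined at the
  origin by \<open>P\<close> if for some radius \<open>R > 0\<close> the value \<open>(\<gamma> f) 0\<close>, for \<open>\<gamma> \<in> \<Gamma>\<close>, depends only on the
  set of those tiles of \<open>\<gamma> P\<close> that meet the closed ball of radius \<open>R\<close> about \<open>0\<close>.

  Equivariance is this property, because every element of \<open>\<Gamma>\<close> is a translation that takes a point
  \<open>x\<close> to \<open>0\<close> followed by an element \<open>A\<close> of the isotropy group; the value at \<open>0\<close> of the transformed
  map is then \<open>\<phi> A (f x)\<close>. Equality of the patches \<open>A (P - x')\<close> and \<open>B (P - x)\<close> near \<open>0\<close> is
  equality of \<open>P - x'\<close> and \<open>A\<inverse> B (P - x)\<close> near \<open>0\<close>, so that only one isotropy element is needed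
  (\<open>equivariant_iff_determined_at_origin\<close>).

  Local derivability differs from it in two respects. It uses the tiles that are contained in a
  ball instead of those that meet a ball, and it speaks about all points of a ball instead of the
  origin. A nonempty tile contained in a ball meets that ball; this turns local derivability into
  determination at the origin. Conversely, bounded components bound the diameters of the tiles by
  some \<open>D\<close>, so a tile that meets the ball of radius \<open>R\<close> about \<open>y\<close> is contained in the ball of
  radius \<open>R + D\<close> about \<open>y\<close>, and a further translation reduces the value at \<open>y\<close> to a value at the
  origin.
\<close>

section \<open>Isometries and patches\<close>

lemma dist_isom_app:
  assumes "\<gamma> \<in> carrier (euclidean_group :: 'n::finite isom monoid)"
  shows "dist (isom_app \<gamma> x) (isom_app \<gamma> y) = dist x y"
proof -
  have "orthogonal_transformation ((*v) (snd \<gamma>))"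
    using assms by (auto simp: euclidean_group_def orthogonal_transformation_matrix)
  then have "norm (snd \<gamma> *v (x - y)) = norm (x - y)"
    by (simp add: orthogonal_transformation)
  then show ?thesis
    by (simp add: isom_app_def dist_norm matrix_vector_mult_diff_distrib)
qed

lemma isom_app_cball:
  assumes "\<gamma> \<in> carrier (euclidean_group :: 'n::finite isom monoid)"
  shows "isom_app \<gamma> ` cball x R = cball (isom_app \<gamma> x) R"
proof (intro equalityI subsetI)
  fix y
  assume "y \<in> cball (isom_app \<gamma> x) R"
  then have "isom_app (inv\<^bsub>euclidean_group\<^esub> \<gamma>) y \<in> cball x R"
    using dist_isom_app[OF assms, of x "isom_app (inv\<^bsub>euclidean_group\<^esub> \<gamma>) y"]
    by (simp add: isom_app_inv(2)[OF assms])
  then show "y \<in> isom_app \<gamma> ` cball x R"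
    by (simp only: isom_app_image_iff(2)[OF assms])
qed (auto simp: dist_isom_app[OF assms])

lemma isom_app_translation [simp]: "isom_app (translation a) x = x + a"
  by (simp add: isom_app_def translation_def)

lemma translation_in_carrier [simp]: "translation a \<in> carrier euclidean_group"
  by (simp add: translation_def euclidean_group_def orthogonal_matrix_id)

lemma isom_app_inv_eqI:
  assumes "\<gamma> \<in> carrier euclidean_group" and "isom_app \<gamma> x = y"
  shows "isom_app (inv\<^bsub>euclidean_group\<^esub> \<gamma>) y = x"
  using isom_app_inv(1)[OF assms(1)] assms(2) by blast

lemma isom_eq_linear_part_translation:
  fixes \<gamma> :: "'n::finite isom"
  assumes "isom_app \<gamma> x = 0"
  shows "\<gamma> = linear_part \<gamma> \<otimes>\<^bsub>euclidean_group\<^esub> translation (- x)"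
proof (cases \<gamma>)
  case (Pair a A)
  then have "A *v x + a = 0"
    using assms by (simp add: isom_app_def)
  then have "A *v (- x) = a"
    using matrix_vector_mult_diff_distrib[of A 0 x] by (simp add: neg_eq_iff_add_eq_0)
  then show ?thesis
    using Pair by (simp add: linear_part_def translation_def euclidean_group_def)
qed

lemma linear_part_isotropy: "\<gamma> \<in> isotropy \<Gamma> \<Longrightarrow> linear_part \<gamma> = \<gamma>"
  by (cases \<gamma>) (simp add: isotropy_def linear_part_def isom_app_def)

lemma linear_part_in_isotropy:
  assumes \<Gamma>: "subgroup \<Gamma> (euclidean_group :: 'n::finite isom monoid)"
    and "range translation \<subseteq> \<Gamma>" and "\<gamma> \<in> \<Gamma>"
  shows "linear_part \<gamma> \<in> isotropy \<Gamma>"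
proof -
  have "linear_part \<gamma> = translation (- fst \<gamma>) \<otimes>\<^bsub>euclidean_group\<^esub> \<gamma>"
    by (cases \<gamma>) (simp add: linear_part_def translation_def euclidean_group_def)
  also have "\<dots> \<in> \<Gamma>"
    using assms by (intro subgroup.m_closed[OF \<Gamma>]) auto
  finally show ?thesis
    by (simp add: isotropy_def linear_part_def isom_app_def)
qed

lemma subgroup_isotropy:
  assumes \<Gamma>: "subgroup \<Gamma> (euclidean_group :: 'n::finite isom monoid)"
  shows "subgroup (isotropy \<Gamma>) euclidean_group"
proof -
  interpret E: group "euclidean_group :: 'n isom monoid"
    by (rule group_euclidean_group)
  show ?thesis
  proof (rule E.subgroupI)
    have "\<one>\<^bsub>euclidean_group\<^esub> \<in> isotropy \<Gamma>"
      using subgroup.one_closed[OF \<Gamma>] by (simp add: isotropy_def isom_app_one)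
    then show "isotropy \<Gamma> \<noteq> {}"
      by blast
  next
    fix \<gamma> :: "'n isom"
    assume "\<gamma> \<in> isotropy \<Gamma>"
    then show "inv\<^bsub>euclidean_group\<^esub> \<gamma> \<in> isotropy \<Gamma>"
      using subgroup.m_inv_closed[OF \<Gamma>] isom_app_inv_eqI[OF subgroup.mem_carrier[OF \<Gamma>]]
      by (simp add: isotropy_def)
  qed (use subgroup.m_closed[OF \<Gamma>] subgroup.mem_carrier[OF \<Gamma>] in
      \<open>auto simp: isotropy_def isom_app_mult\<close>)
qed

lemma patch_act_mult:
  "patch_act (\<gamma> \<otimes>\<^bsub>euclidean_group\<^esub> \<eta>) P = patch_act \<gamma> (patch_act \<eta> P)"
  by (simp add: patch_act_def image_image isom_app_mult)

lemma patch_act_one: "patch_act \<one>\<^bsub>euclidean_group\<^esub> P = P"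
  by (simp add: patch_act_def isom_app_one)

lemma patch_act_patch_meet_cball:
  assumes "\<gamma> \<in> carrier (euclidean_group :: 'n::finite isom monoid)"
  shows "patch_act \<gamma> (patch_meet P (cball x R)) = patch_meet (patch_act \<gamma> P) (cball (isom_app \<gamma> x) R)"
proof -
  have "inj (isom_app \<gamma>)"
    using isom_app_inv(1)[OF assms] by (rule inj_on_inverseI)
  then have "isom_app \<gamma> ` T \<inter> isom_app \<gamma> ` C = {} \<longleftrightarrow> T \<inter> C = {}" for T C
    by (simp flip: image_Int)
  then show ?thesis
    unfolding isom_app_cball[OF assms, symmetric] by (auto simp: patch_act_def patch_meet_def)
qed

text \<open>
  Cutting a patch off at the closure of one of its tiles \<open>T\<close> leaves \<open>T\<close> alone, since any other
  tile in that closure would be an open set that meets \<open>T\<close>. Hence the defining property of bounded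
  components, applied to this closed set, is a statement about the single tile \<open>T\<close>.
\<close>

lemma bounded_components_imp_tiles_bounded:
  assumes P: "patch P" and "bounded_components P"
  obtains D where "D > 0" and "\<And>T z. T \<in> P \<Longrightarrow> z \<in> T \<Longrightarrow> T \<subseteq> cball z D"
proof -
  obtain D where D: "D > 0"
    "\<And>C x. closed C \<Longrightarrow> x \<in> patch_supp (patch_cut P C) \<Longrightarrow>
       x \<in> patch_supp (patch_cut (patch_cut P C) (cball x D))"
    using assms(2) unfolding bounded_components_def by blast
  have "T \<subseteq> cball z D" if T: "T \<in> P" "z \<in> T" for T z
  proof -
    have "S = T" if "S \<in> P" "S \<subseteq> closure T" for S
    proof -
      have "open S" "S \<noteq> {}"
        using P that(1) by (auto simp: patch_def tile_def)
      then have "S \<inter> T \<noteq> {}"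
        using open_Int_closure_eq_empty[of S T] that(2) by blast
      then show ?thesis
        using P that(1) T(1) by (auto simp: patch_def)
    qed
    then have cut: "patch_cut P (closure T) = {T}"
      using T(1) closure_subset[of T] by (auto simp: patch_cut_def)
    have "z \<in> patch_supp (patch_cut P (closure T))"
      using T(2) closure_subset[of T] by (auto simp: cut patch_supp_def)
    then have "z \<in> patch_supp (patch_cut {T} (cball z D))"
      using D(2)[of "closure T" z] by (simp add: cut)
    then have "patch_cut {T} (cball z D) \<noteq> {}"
      by (auto simp: patch_supp_def)
    then show ?thesis
      by (auto simp: patch_cut_def)
  qed
  then show thesis
    using that D(1) by blast
qed

text \<open>
  A nonempty tile contained in \<open>B\<close> meets every superset \<open>C\<close> of \<open>B\<close>, so the cut-off at \<open>B\<close> can be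
  recovered from the tiles that meet \<open>C\<close>. The converse passage, in the lemma thereafter, needs tiles
  that do not reach far beyond \<open>C\<close>.
\<close>

lemma patch_cut_eq_if_patch_meet_eq:
  assumes "patch_meet P C = patch_meet Q C" and "B \<subseteq> C"
    and "{} \<notin> P" and "{} \<notin> Q"
  shows "patch_cut P B = patch_cut Q B"
proof -
  have cut: "patch_cut X B = patch_cut (patch_meet X C) B" if "{} \<notin> X" for X
  proof -
    have "T \<inter> C \<noteq> {}" if "T \<in> X" "T \<subseteq> B" for T
      using \<open>{} \<notin> X\<close> that \<open>B \<subseteq> C\<close> by (metis Int_absorb2 subset_trans)
    then show ?thesis
      unfolding patch_cut_def patch_meet_def by auto
  qed
  show ?thesis
    using cut[OF assms(3)] cut[OF assms(4)] assms(1) by simp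
qed

lemma patch_meet_eq_if_patch_cut_eq:
  assumes "patch_cut P B = patch_cut Q B"
    and "\<And>T z. T \<in> P \<union> Q \<Longrightarrow> z \<in> T \<Longrightarrow> z \<in> C \<Longrightarrow> T \<subseteq> B"
  shows "patch_meet P C = patch_meet Q C"
proof -
  have "patch_meet X C = patch_meet (patch_cut X B) C" if "X \<subseteq> P \<union> Q" for X
    using assms(2) that unfolding patch_cut_def patch_meet_def by blast
  then show ?thesis
    using assms(1) by (metis Un_upper1 Un_upper2)
qed

section \<open>Transformed maps\<close>

lemma map_act_translation_mult:
  assumes "\<gamma> \<in> carrier (euclidean_group :: 'n::finite isom monoid)"
  shows "map_act \<phi> (translation (- y) \<otimes>\<^bsub>euclidean_group\<^esub> \<gamma>) f 0 = map_act \<phi> \<gamma> f y"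
proof -
  interpret E: group "euclidean_group :: 'n isom monoid"
    by (rule group_euclidean_group)
  have "isom_app (inv\<^bsub>euclidean_group\<^esub> (translation (- y) \<otimes>\<^bsub>euclidean_group\<^esub> \<gamma>)) 0
      = isom_app (inv\<^bsub>euclidean_group\<^esub> \<gamma>) y"
    using assms isom_app_inv(2)[OF assms]
    by (intro isom_app_inv_eqI) (auto simp: isom_app_mult)
  moreover have "linear_part (translation (- y) \<otimes>\<^bsub>euclidean_group\<^esub> \<gamma>) = linear_part \<gamma>"
    by (simp add: linear_part_def translation_def euclidean_group_def split: prod.split)
  ultimately show ?thesis
    by (simp add: map_act_def)
qed

lemma map_act_isotropy_mult_translation:
  assumes \<Gamma>: "subgroup \<Gamma> (euclidean_group :: 'n::finite isom monoid)" and \<gamma>: "\<gamma> \<in> isotropy \<Gamma>"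
  shows "map_act \<phi> (\<gamma> \<otimes>\<^bsub>euclidean_group\<^esub> translation (- x)) f 0 = \<phi> \<gamma> (f x)"
proof -
  interpret E: group "euclidean_group :: 'n isom monoid"
    by (rule group_euclidean_group)
  have "\<gamma> \<in> carrier euclidean_group" "isom_app \<gamma> 0 = 0"
    using \<gamma> subgroup.mem_carrier[OF \<Gamma>] by (auto simp: isotropy_def)
  then have "isom_app (inv\<^bsub>euclidean_group\<^esub> (\<gamma> \<otimes>\<^bsub>euclidean_group\<^esub> translation (- x))) 0 = x"
    by (intro isom_app_inv_eqI) (auto simp: isom_app_mult)
  moreover have "linear_part (\<gamma> \<otimes>\<^bsub>euclidean_group\<^esub> translation (- x)) = \<gamma>"
    using linear_part_isotropy[OF \<gamma>]
    by (cases \<gamma>) (simp add: linear_part_def translation_def euclidean_group_def)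
  ultimately show ?thesis
    by (simp add: map_act_def)
qed

text \<open>
  On constant maps the pattern space action is \<open>\<phi>\<close> itself, so the laws of the action of \<open>\<Gamma>\<close> on
  maps specialise to the statement that \<open>\<phi>\<close> is an action of the isotropy group.
\<close>

lemma isotropy_representation:
  assumes \<Gamma>: "subgroup \<Gamma> (euclidean_group :: 'n::finite isom monoid)"
    and "range translation \<subseteq> \<Gamma>" and "comm_group G"
    and "\<phi> \<in> hom (euclidean_group\<lparr>carrier := isotropy \<Gamma>\<rparr>) (AutoGroup G)"
    and u: "u \<in> carrier G"
  shows "\<phi> \<one>\<^bsub>euclidean_group\<^esub> u = u"
    and "\<lbrakk>\<gamma> \<in> isotropy \<Gamma>; \<eta> \<in> isotropy \<Gamma>\<rbrakk> \<Longrightarrow> \<phi> (\<gamma> \<otimes>\<^bsub>euclidean_group\<^esub> \<eta>) u = \<phi> \<gamma> (\<phi> \<eta> u)"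
proof -
  interpret abstract_pattern_space "euclidean_group\<lparr>carrier := \<Gamma>\<rparr>" isom_app "map_space G \<phi>"
    using assms(1-4) by (rule abstract_pattern_space_map_space)
  have const: "(\<lambda>_. u) \<in> carrier (map_space G \<phi>)"
    using u by (simp add: map_space_def)
  show "\<phi> \<one>\<^bsub>euclidean_group\<^esub> u = u"
    using fun_cong[OF act_one[OF const], of 0]
    by (simp add: map_space_def map_act_def linear_part_one)
  show "\<phi> (\<gamma> \<otimes>\<^bsub>euclidean_group\<^esub> \<eta>) u = \<phi> \<gamma> (\<phi> \<eta> u)"
    if iso: "\<gamma> \<in> isotropy \<Gamma>" "\<eta> \<in> isotropy \<Gamma>"
  proof -
    have "\<gamma> \<in> \<Gamma>" "\<eta> \<in> \<Gamma>"
      using iso by (auto simp: isotropy_def)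
    then show ?thesis
      using fun_cong[OF act_mult[OF _ _ const], of \<gamma> \<eta> 0]
      by (simp add: map_space_def map_act_def linear_part_mult linear_part_isotropy[OF iso(1)]
          linear_part_isotropy[OF iso(2)])
  qed
qed

section \<open>Determination at the origin\<close>

definition determined_at_origin ::
  "'n::finite isom set \<Rightarrow> (real^'n) set set \<Rightarrow> ('n isom \<Rightarrow> 'g \<Rightarrow> 'g) \<Rightarrow> (real^'n \<Rightarrow> 'g) \<Rightarrow> bool"
  where
  "determined_at_origin \<Gamma> P \<phi> f \<longleftrightarrow>
     (\<exists>R>0. \<forall>\<gamma>\<in>\<Gamma>. \<forall>\<eta>\<in>\<Gamma>.
        patch_meet (patch_act \<gamma> P) (cball 0 R) = patch_meet (patch_act \<eta> P) (cball 0 R) \<longrightarrow>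
        map_act \<phi> \<gamma> f 0 = map_act \<phi> \<eta> f 0)"

text \<open>
  The premise of equivariance for \<open>x'\<close>, \<open>x\<close> and \<open>\<gamma>\<close> compares the transforms of the patch under
  the two isometries \<open>z \<mapsto> z - x'\<close> and \<open>z \<mapsto> \<gamma> (z - x)\<close>. Any two elements of \<open>\<Gamma>\<close> are brought to
  this form by composing both with the inverse of the linear part of the first one.
\<close>

lemma equivariant_iff_determined_at_origin:
  fixes P :: "(real^'n::finite) set set"
  assumes \<Gamma>: "subgroup \<Gamma> (euclidean_group :: 'n isom monoid)"
    and trans: "range translation \<subseteq> \<Gamma>" and G: "comm_group G"
    and \<phi>: "\<phi> \<in> hom (euclidean_group\<lparr>carrier := isotropy \<Gamma>\<rparr>) (AutoGroup G)"
    and f: "f \<in> UNIV \<rightarrow> carrier G"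
  shows "equivariant (isotropy \<Gamma>) P \<phi> f \<longleftrightarrow> determined_at_origin \<Gamma> P \<phi> f"
proof -
  interpret E: group "euclidean_group :: 'n isom monoid"
    by (rule group_euclidean_group)
  let ?mult = "(\<otimes>\<^bsub>euclidean_group\<^esub>) :: 'n isom \<Rightarrow> 'n isom \<Rightarrow> 'n isom"
  note iso = subgroup_isotropy[OF \<Gamma>]
  note rep = isotropy_representation[OF \<Gamma> trans G \<phi>]
  have f_closed: "f x \<in> carrier G" for x
    using f by auto
  have tr: "translation a \<in> \<Gamma>" for a
    using trans by auto
  have meet_translation: "patch_act (translation (- x)) (patch_meet P (cball x R))
      = patch_meet (patch_act (translation (- x)) P) (cball 0 R)" for x :: "real^'n" and R
    by (simp add: patch_act_patch_meet_cball)
  have meet_isotropy: "patch_act \<gamma> (patch_act (translation (- x)) (patch_meet P (cball x R)))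
      = patch_meet (patch_act (?mult \<gamma> (translation (- x))) P) (cball 0 R)"
    if "\<gamma> \<in> isotropy \<Gamma>" for \<gamma> x R
    using that subgroup.mem_carrier[OF iso that]
    by (simp add: meet_translation patch_act_patch_meet_cball patch_act_mult isotropy_def)
  show ?thesis
  proof
    assume "equivariant (isotropy \<Gamma>) P \<phi> f"
    then obtain R where "R > 0" and equi: "\<And>x x' \<gamma>. \<gamma> \<in> isotropy \<Gamma> \<Longrightarrow>
        patch_act (translation (- x')) (patch_meet P (cball x' R)) =
        patch_act \<gamma> (patch_act (translation (- x)) (patch_meet P (cball x R))) \<Longrightarrow>
        f x' = \<phi> \<gamma> (f x)"
      unfolding equivariant_def by blast
    have "map_act \<phi> \<gamma> f 0 = map_act \<phi> \<eta> f 0"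
      if mem: "\<gamma> \<in> \<Gamma>" "\<eta> \<in> \<Gamma>" and meet:
        "patch_meet (patch_act \<gamma> P) (cball 0 R) = patch_meet (patch_act \<eta> P) (cball 0 R)"
      for \<gamma> \<eta>
    proof -
      define A B where "A = linear_part \<gamma>" and "B = linear_part \<eta>"
      define x' x where "x' = isom_app (inv\<^bsub>euclidean_group\<^esub> \<gamma>) 0"
        and "x = isom_app (inv\<^bsub>euclidean_group\<^esub> \<eta>) 0"
      have AB: "A \<in> isotropy \<Gamma>" "B \<in> isotropy \<Gamma>"
        unfolding A_def B_def using linear_part_in_isotropy[OF \<Gamma> trans] mem by auto
      have carr: "A \<in> carrier euclidean_group" "B \<in> carrier euclidean_group"
        using subgroup.mem_carrier[OF iso] AB by auto
      have invA: "inv\<^bsub>euclidean_group\<^esub> A \<in> isotropy \<Gamma>"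
        using subgroup.m_inv_closed[OF iso AB(1)] .
      have C: "?mult (inv\<^bsub>euclidean_group\<^esub> A) B \<in> isotropy \<Gamma>"
        using subgroup.m_closed[OF iso invA AB(2)] .
      have decomp: "\<gamma> = ?mult A (translation (- x'))" "\<eta> = ?mult B (translation (- x))"
        unfolding A_def B_def
        using isom_eq_linear_part_translation isom_app_inv(2) subgroup.mem_carrier[OF \<Gamma>] mem
        by (metis x'_def, metis x_def)
      have "patch_act A (patch_act (translation (- x')) (patch_meet P (cball x' R)))
          = patch_act B (patch_act (translation (- x)) (patch_meet P (cball x R)))"
        using meet by (simp add: meet_isotropy AB decomp)
      then have "patch_act (?mult (inv\<^bsub>euclidean_group\<^esub> A) A)
            (patch_act (translation (- x')) (patch_meet P (cball x' R)))
          = patch_act (?mult (inv\<^bsub>euclidean_group\<^esub> A) B)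
            (patch_act (translation (- x)) (patch_meet P (cball x R)))"
        unfolding patch_act_mult by simp
      then have "patch_act (translation (- x')) (patch_meet P (cball x' R))
          = patch_act (?mult (inv\<^bsub>euclidean_group\<^esub> A) B)
            (patch_act (translation (- x)) (patch_meet P (cball x R)))"
        by (simp add: E.l_inv[OF carr(1)] patch_act_one)
      then have "f x' = \<phi> (?mult (inv\<^bsub>euclidean_group\<^esub> A) B) (f x)"
        by (rule equi[OF C])
      then have "\<phi> A (f x') = \<phi> (?mult A (?mult (inv\<^bsub>euclidean_group\<^esub> A) B)) (f x)"
        using rep(2)[OF f_closed AB(1) C] by simp
      also have "?mult A (?mult (inv\<^bsub>euclidean_group\<^esub> A) B) = B"
        using carr by (simp add: E.m_assoc[symmetric])
      finally show ?thesis
        unfolding decomp map_act_isotropy_mult_translation[OF \<Gamma> AB(1)]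
          map_act_isotropy_mult_translation[OF \<Gamma> AB(2)] .
    qed
    then show "determined_at_origin \<Gamma> P \<phi> f"
      unfolding determined_at_origin_def using \<open>R > 0\<close> by blast
  next
    assume "determined_at_origin \<Gamma> P \<phi> f"
    then obtain R where "R > 0" and det: "\<And>\<gamma> \<eta>. \<gamma> \<in> \<Gamma> \<Longrightarrow> \<eta> \<in> \<Gamma> \<Longrightarrow>
        patch_meet (patch_act \<gamma> P) (cball 0 R) = patch_meet (patch_act \<eta> P) (cball 0 R) \<Longrightarrow>
        map_act \<phi> \<gamma> f 0 = map_act \<phi> \<eta> f 0"
      unfolding determined_at_origin_def by blast
    have "f x' = \<phi> \<gamma> (f x)"
      if \<gamma>: "\<gamma> \<in> isotropy \<Gamma>" and meet:
        "patch_act (translation (- x')) (patch_meet P (cball x' R)) =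
         patch_act \<gamma> (patch_act (translation (- x)) (patch_meet P (cball x R)))" for x x' \<gamma>
    proof -
      have "\<gamma> \<in> \<Gamma>"
        using \<gamma> by (simp add: isotropy_def)
      then have "?mult \<gamma> (translation (- x)) \<in> \<Gamma>"
        using subgroup.m_closed[OF \<Gamma> _ tr] by blast
      then have "map_act \<phi> (translation (- x')) f 0 = map_act \<phi> (?mult \<gamma> (translation (- x))) f 0"
        using meet[unfolded meet_isotropy[OF \<gamma>]] meet_translation by (intro det tr) simp_all
      moreover have "map_act \<phi> (translation (- x')) f 0 = f x'"
        using map_act_isotropy_mult_translation[OF \<Gamma> subgroup.one_closed[OF iso], of \<phi> x' f]
        by (simp add: rep(1)[OF f_closed])
      ultimately show ?thesis
        by (simp add: map_act_isotropy_mult_translation[OF \<Gamma> \<gamma>])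
    qed
    then show "equivariant (isotropy \<Gamma>) P \<phi> f"
      unfolding equivariant_def using \<open>R > 0\<close> by blast
  qed
qed

text \<open>
  Equality at the single point \<open>y\<^sub>0\<close>, the case of radius \<open>0\<close> in local derivability, suffices. The
  points \<open>x\<^sub>0\<close> and \<open>y\<^sub>0\<close> may be far apart; their distance is added to the radius.
\<close>

lemma locally_derivable_imp_determined_at_origin:
  fixes P :: "(real^'n::finite) set set"
  assumes \<Gamma>: "subgroup \<Gamma> (euclidean_group :: 'n isom monoid)"
    and trans: "range translation \<subseteq> \<Gamma>"
    and nonempty: "{} \<notin> P"
    and "locally_derivable \<Gamma> patch_space (map_space G \<phi>) P f"
  shows "determined_at_origin \<Gamma> P \<phi> f"
proof -
  let ?mult = "(\<otimes>\<^bsub>euclidean_group\<^esub>) :: 'n isom \<Rightarrow> 'n isom \<Rightarrow> 'n isom"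
  obtain x\<^sub>0 y\<^sub>0 R\<^sub>0 where "R\<^sub>0 \<ge> 0" and der: "\<And>\<gamma> \<eta> R. \<lbrakk>\<gamma> \<in> \<Gamma>; \<eta> \<in> \<Gamma>; R \<ge> 0;
      patch_cut (patch_act \<gamma> P) (cball x\<^sub>0 (R + R\<^sub>0)) = patch_cut (patch_act \<eta> P) (cball x\<^sub>0 (R + R\<^sub>0))\<rbrakk>
      \<Longrightarrow> map_cut G (map_act \<phi> \<gamma> f) (cball y\<^sub>0 R) = map_cut G (map_act \<phi> \<eta> f) (cball y\<^sub>0 R)"
    using assms(4) unfolding locally_derivable_def patch_space_def map_space_def by fastforce
  \<comment> \<open>The summand 1 only makes the radius positive.\<close>
  define R where "R = R\<^sub>0 + dist x\<^sub>0 y\<^sub>0 + 1"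
  have "R > 0"
    using \<open>R\<^sub>0 \<ge> 0\<close> zero_le_dist[of x\<^sub>0 y\<^sub>0] unfolding R_def by linarith
  have "map_act \<phi> \<gamma> f 0 = map_act \<phi> \<eta> f 0"
    if mem: "\<gamma> \<in> \<Gamma>" "\<eta> \<in> \<Gamma>" and meet:
      "patch_meet (patch_act \<gamma> P) (cball 0 R) = patch_meet (patch_act \<eta> P) (cball 0 R)"
    for \<gamma> \<eta>
  proof -
    define \<gamma>' \<eta>' where "\<gamma>' = ?mult (translation y\<^sub>0) \<gamma>" and "\<eta>' = ?mult (translation y\<^sub>0) \<eta>"
    have mem': "\<gamma>' \<in> \<Gamma>" "\<eta>' \<in> \<Gamma>"
      unfolding \<gamma>'_def \<eta>'_def using subgroup.m_closed[OF \<Gamma> subsetD[OF trans rangeI]] mem by simp_all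
    have "patch_act (translation y\<^sub>0) (patch_meet (patch_act \<gamma> P) (cball 0 R))
        = patch_act (translation y\<^sub>0) (patch_meet (patch_act \<eta> P) (cball 0 R))"
      using meet by simp
    then have "patch_meet (patch_act \<gamma>' P) (cball y\<^sub>0 R) = patch_meet (patch_act \<eta>' P) (cball y\<^sub>0 R)"
      by (simp add: patch_act_patch_meet_cball patch_act_mult \<gamma>'_def \<eta>'_def)
    moreover have "cball x\<^sub>0 R\<^sub>0 \<subseteq> cball y\<^sub>0 R"
    proof
      fix z
      assume "z \<in> cball x\<^sub>0 R\<^sub>0"
      then show "z \<in> cball y\<^sub>0 R"
        using dist_triangle[of y\<^sub>0 z x\<^sub>0] by (simp add: R_def dist_commute)
    qed
    ultimately have "patch_cut (patch_act \<gamma>' P) (cball x\<^sub>0 R\<^sub>0) = patch_cut (patch_act \<eta>' P) (cball x\<^sub>0 R\<^sub>0)"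
      using nonempty by (intro patch_cut_eq_if_patch_meet_eq) (auto simp: patch_act_def)
    then have "map_cut G (map_act \<phi> \<gamma>' f) (cball y\<^sub>0 0) y\<^sub>0 = map_cut G (map_act \<phi> \<eta>' f) (cball y\<^sub>0 0) y\<^sub>0"
      using der[OF mem', of 0] by simp
    then have "map_act \<phi> \<gamma>' f y\<^sub>0 = map_act \<phi> \<eta>' f y\<^sub>0"
      by (simp add: map_cut_def)
    moreover have "?mult (translation (- y\<^sub>0)) (?mult (translation y\<^sub>0) \<zeta>) = \<zeta>" for \<zeta>
      by (cases \<zeta>) (simp add: translation_def euclidean_group_def)
    ultimately show ?thesis
      using map_act_translation_mult[of \<gamma>' \<phi> y\<^sub>0 f] map_act_translation_mult[of \<eta>' \<phi> y\<^sub>0 f]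
        subgroup.mem_carrier[OF \<Gamma>] mem' by (simp add: \<gamma>'_def \<eta>'_def)
  qed
  then show ?thesis
    unfolding determined_at_origin_def using \<open>R > 0\<close> by blast
qed

text \<open>
  The base points of the local derivation are both \<open>0\<close> and its radius is \<open>R + D\<close>, where \<open>D\<close> bounds
  the size of the tiles: the patch inside the ball of radius \<open>r + R + D\<close> contains every tile that
  meets the ball of radius \<open>R\<close> about a point of the ball of radius \<open>r\<close>.
\<close>

lemma determined_at_origin_imp_locally_derivable:
  fixes P :: "(real^'n::finite) set set"
  assumes \<Gamma>: "subgroup \<Gamma> (euclidean_group :: 'n isom monoid)"
    and trans: "range translation \<subseteq> \<Gamma>"
    and "D \<ge> 0" and D: "\<And>T z. T \<in> P \<Longrightarrow> z \<in> T \<Longrightarrow> T \<subseteq> cball z D"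
    and "determined_at_origin \<Gamma> P \<phi> f"
  shows "locally_derivable \<Gamma> patch_space (map_space G \<phi>) P f"
proof -
  let ?mult = "(\<otimes>\<^bsub>euclidean_group\<^esub>) :: 'n isom \<Rightarrow> 'n isom \<Rightarrow> 'n isom"
  obtain R where "R > 0" and det: "\<And>\<gamma> \<eta>. \<gamma> \<in> \<Gamma> \<Longrightarrow> \<eta> \<in> \<Gamma> \<Longrightarrow>
      patch_meet (patch_act \<gamma> P) (cball 0 R) = patch_meet (patch_act \<eta> P) (cball 0 R) \<Longrightarrow>
      map_act \<phi> \<gamma> f 0 = map_act \<phi> \<eta> f 0"
    using assms(5) unfolding determined_at_origin_def by blast
  have D_act: "T \<subseteq> cball z D" if \<gamma>: "\<gamma> \<in> \<Gamma>" and T: "T \<in> patch_act \<gamma> P" "z \<in> T" for \<gamma> T z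
  proof -
    obtain S w where "S \<in> P" "T = isom_app \<gamma> ` S" "w \<in> S" "z = isom_app \<gamma> w"
      using T by (auto simp: patch_act_def)
    then show ?thesis
      using image_mono[OF D, of S w "isom_app \<gamma>"] isom_app_cball[OF subgroup.mem_carrier[OF \<Gamma> \<gamma>]]
      by simp
  qed
  have value_eq: "map_act \<phi> \<gamma> f y = map_act \<phi> \<eta> f y"
    if mem: "\<gamma> \<in> \<Gamma>" "\<eta> \<in> \<Gamma>" and y: "y \<in> cball 0 r" and
      cut: "patch_cut (patch_act \<gamma> P) (cball 0 (r + (R + D)))
          = patch_cut (patch_act \<eta> P) (cball 0 (r + (R + D)))" for \<gamma> \<eta> r y
  proof -
    have "T \<subseteq> cball 0 (r + (R + D))"
      if T: "T \<in> patch_act \<gamma> P \<union> patch_act \<eta> P" "z \<in> T" "z \<in> cball y R" for T z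
    proof
      fix w
      assume "w \<in> T"
      moreover have "T \<subseteq> cball z D"
        using T(1) D_act[OF mem(1) _ T(2)] D_act[OF mem(2) _ T(2)] by blast
      ultimately have "dist z w \<le> D"
        by auto
      then show "w \<in> cball 0 (r + (R + D))"
        using y T(3) dist_triangle[of 0 w y] dist_triangle[of y w z] by simp
    qed
    with cut have "patch_meet (patch_act \<gamma> P) (cball y R) = patch_meet (patch_act \<eta> P) (cball y R)"
      by (rule patch_meet_eq_if_patch_cut_eq)
    then have "patch_act (translation (- y)) (patch_meet (patch_act \<gamma> P) (cball y R))
        = patch_act (translation (- y)) (patch_meet (patch_act \<eta> P) (cball y R))"
      by simp
    then have "patch_meet (patch_act (?mult (translation (- y)) \<gamma>) P) (cball 0 R)
        = patch_meet (patch_act (?mult (translation (- y)) \<eta>) P) (cball 0 R)"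
      by (simp add: patch_act_patch_meet_cball patch_act_mult)
    moreover have "?mult (translation (- y)) \<gamma> \<in> \<Gamma>" "?mult (translation (- y)) \<eta> \<in> \<Gamma>"
      using subgroup.m_closed[OF \<Gamma> subsetD[OF trans rangeI]] mem by simp_all
    ultimately have "map_act \<phi> (?mult (translation (- y)) \<gamma>) f 0
        = map_act \<phi> (?mult (translation (- y)) \<eta>) f 0"
      by (intro det)
    then show ?thesis
      unfolding map_act_translation_mult[OF subgroup.mem_carrier[OF \<Gamma> mem(1)]]
        map_act_translation_mult[OF subgroup.mem_carrier[OF \<Gamma> mem(2)]] .
  qed
  have "map_cut G (map_act \<phi> \<gamma> f) (cball 0 r) = map_cut G (map_act \<phi> \<eta> f) (cball 0 r)"
    if "\<gamma> \<in> \<Gamma>" "\<eta> \<in> \<Gamma>" "patch_cut (patch_act \<gamma> P) (cball 0 (r + (R + D)))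
          = patch_cut (patch_act \<eta> P) (cball 0 (r + (R + D)))" for \<gamma> \<eta> r
    using value_eq[OF that(1,2) _ that(3)] by (simp add: map_cut_def fun_eq_iff)
  moreover have "R + D \<ge> 0"
    using \<open>R > 0\<close> \<open>D \<ge> 0\<close> by linarith
  ultimately show ?thesis
    unfolding locally_derivable_def patch_space_def map_space_def pattern_space.simps by blast
qed

section \<open>Equivariance and local derivability\<close>

theorem lemma5p8:
  fixes \<T> :: "(real^'n::finite) set set"
    and \<Gamma> :: "'n isom set"
    and G :: "('g, 'b) monoid_scheme"
    and \<phi> :: "'n isom \<Rightarrow> 'g \<Rightarrow> 'g"
    and f :: "real^'n \<Rightarrow> 'g"
  assumes "tiling \<T>" and "bounded_components \<T>"
    and "subgroup \<Gamma> euclidean_group"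
    and "closedin (top_of_set (carrier euclidean_group)) \<Gamma>"
    and "range translation \<subseteq> \<Gamma>"
    and "comm_group G"
    and "\<phi> \<in> hom (euclidean_group\<lparr>carrier := isotropy \<Gamma>\<rparr>) (AutoGroup G)"
    and "f \<in> UNIV \<rightarrow> carrier G"
  shows "equivariant (isotropy \<Gamma>) \<T> \<phi> f \<longleftrightarrow>
         locally_derivable \<Gamma> patch_space (map_space G \<phi>) \<T> f"
proof -
  have patch: "patch \<T>"
    using assms(1) by (simp add: tiling_def)
  then have nonempty: "{} \<notin> \<T>"
    by (auto simp: patch_def tile_def)
  obtain D where "D > 0" and D: "\<And>T z. T \<in> \<T> \<Longrightarrow> z \<in> T \<Longrightarrow> T \<subseteq> cball z D"
    using bounded_components_imp_tiles_bounded[OF patch assms(2)] by blast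
  have "equivariant (isotropy \<Gamma>) \<T> \<phi> f \<longleftrightarrow> determined_at_origin \<Gamma> \<T> \<phi> f"
    using assms(3,5-8) by (rule equivariant_iff_determined_at_origin)
  also have "\<dots> \<longleftrightarrow> locally_derivable \<Gamma> patch_space (map_space G \<phi>) \<T> f"
    using determined_at_origin_imp_locally_derivable[OF assms(3,5) _ D] \<open>D > 0\<close>
      locally_derivable_imp_determined_at_origin[OF assms(3,5) nonempty] by (meson less_imp_le)
  finally show ?thesis .
qed

end
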